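(* Let $\mathbf{X}$ be a $d$-dimensional random vector and $\mathbf{Z}$ a random vector with values in $\mathcal{Z}\subseteq\mathbb{R}^p$, with conditional joint cumulative distribution functions $F_{\mathbf{X}|\mathbf{Z}=\mathbf{z}}$, $\mathbf{z}\in\mathcal{Z}$, whose margins are not assumed to be continuous. Consider the assumptions $$\mathcal{H}_0^{\text{equality}}:\ \forall \mathbf{z},\mathbf{z}'\in\mathcal{Z},\ \mathcal{C}(F_{\mathbf{X}|\mathbf{Z}=\mathbf{z}})=\mathcal{C}(F_{\mathbf{X}|\mathbf{Z}=\mathbf{z}'});$$ $$\mathcal{H}_0^{\text{intersection}}:\ \bigcap_{\mathbf{z}\in\mathcal{Z}}\mathcal{C}(F_{\mathbf{X}|\mathbf{Z}=\mathbf{z}})\neq\emptyset;$$ $$\mathcal{H}_0^{\text{pairwise}}:\ \forall \mathbf{z},\mathbf{z}'\in\mathcal{Z},\ \mathcal{C}(F_{\mathbf{X}|\mathbf{Z}=\mathbf{z}})\cap\mathcal{C}(F_{\mathbf{X}|\mathbf{Z}=\mathbf{z}'})\neq\emptyset;$$ $$\mathcal{H}_0^{\text{Dom}}:\ \forall \mathbf{z},\mathbf{z}'\in\mathcal{Z},\ \forall\mathbf{u}\in\mathrm{Dom}_{\mathbf{z}}\cap\mathrm{Dom}_{\mathbf{z}'},\ C_{\mathbf{X}|\mathbf{Z}=\mathbf{z}}(\mathbf{u})=C_{\mathbf{X}|\mathbf{Z}=\mathbf{z}'}(\mathbf{u}).$$ Then the following implications hold: $$\mathcal{H}_0^{\t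ext{equality}}\Longrightarrow\mathcal{H}_0^{\text{intersection}}\Longrightarrow\mathcal{H}_0^{\text{pairwise}}\Longrightarrow\mathcal{H}_0^{\text{Dom}}.$$
   Context: For a $d$-dimensional joint cumulative distribution function $F$ with margins $F_1,\dots,F_d$, $\mathcal{C}(F)$ denotes the set of copulas that are possible copulas of $F$, i.e. the set of $d$-dimensional copulas $C$ with $F(x_1,\dots,x_d)=C(F_1(x_1),\dots,F_d(x_d))$ for all $(x_1,\dots,x_d)\in\mathbb{R}^d$ (non-empty by Sklar's theorem). For $\mathbf{z}\in\mathcal{Z}$, $F_{X_i|\mathbf{Z}=\mathbf{z}}$ is the $i$-th margin of $F_{\mathbf{X}|\mathbf{Z}=\mathbf{z}}$, $\mathrm{Ran}$ denotes the range of a function, and $\mathrm{Dom}_{\mathbf{z}}:=\mathrm{Ran}(F_{X_1|\mathbf{Z}=\mathbf{z}})\times\cdots\times\mathrm{Ran}(F_{X_d|\mathbf{Z}=\mathbf{z}})$. The conditional copula $C_{\mathbf{X}|\mathbf{Z}=\mathbf{z}}$ (any element of $\mathcal{C}(F_{\mathbf{X}|\mathbf{Z}=\mathbf{z}})$) is uniquely determined on $\mathrm{Dom}_{\mathbf{z}}$, that is, all elements of $\mathcal{C}(F_{\mathbf{X}|\mathbf{Z}=\mathbf{z}})$ coincide on $\mathrm{Dom}_{\mathbf{z}}$; so for $\mathbf{u}\in\mathrm{Dom}_{\mathbf{z}}$ the value $C_{\mathbf{X}|\mathbf{Z}=\mathbf{z}}(\mathbf{u})$ is well-defined. *)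

theory Defs
  imports "HOL-Probability.Probability"
begin

(* The order on real ^ 'd is componentwise, so {..x} is the lower orthant at x. *)
definition joint_cdf :: "(real ^ 'd) measure \<Rightarrow> real ^ 'd \<Rightarrow> real" where
  "joint_cdf \<mu> x = measure \<mu> {..x}"

definition is_joint_cdf :: "(real ^ 'd \<Rightarrow> real) \<Rightarrow> bool" where
  "is_joint_cdf F \<longleftrightarrow>
     (\<exists>\<mu>. prob_space \<mu> \<and> sets \<mu> = sets borel \<and> F = joint_cdf \<mu>)"

(* F_i(t) = F(\<infinity>,...,\<infinity>,t,\<infinity>,...,\<infinity>) with t in position i; for a joint cdf the limit
   exists because F is monotone and bounded. *)
definition margin :: "(real ^ 'd \<Rightarrow> real) \<Rightarrow> 'd \<Rightarrow> real \<Rightarrow> real" where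
  "margin F i t = Lim at_top (\<lambda>s. F (\<chi> j. if j = i then t else s))"

definition unit_cube :: "(real ^ 'd) set" where
  "unit_cube = {u. \<forall>i. 0 \<le> u $ i \<and> u $ i \<le> 1}"

(* A copula is a function on the unit cube, namely the distribution function of a probability
   measure whose univariate margins are all uniform on [0,1]. Extensionality makes equality of
   functions on real ^ 'd the same as equality on the cube. *)
definition is_copula :: "(real ^ 'd \<Rightarrow> real) \<Rightarrow> bool" where
  "is_copula C \<longleftrightarrow> C \<in> extensional unit_cube \<and>
     (\<exists>\<mu>. prob_space \<mu> \<and> sets \<mu> = sets borel \<and>
        (\<forall>i. distr \<mu> borel (\<lambda>x. x $ i) = uniform_measure lborel {0..1}) \<and>
        (\<forall>u\<in>unit_cube. C u = joint_cdf \<mu> u))"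

definition possible_copulas :: "(real ^ 'd \<Rightarrow> real) \<Rightarrow> (real ^ 'd \<Rightarrow> real) set" where
  "possible_copulas F = {C. is_copula C \<and> (\<forall>x. F x = C (\<chi> i. margin F i (x $ i)))}"

definition Dom :: "(real ^ 'd \<Rightarrow> real) \<Rightarrow> (real ^ 'd) set" where
  "Dom F = {u. \<forall>i. u $ i \<in> range (margin F i)}"

(* F is a version of the conditional joint cdf of X given Z:
   P(X \<le> x, Z \<in> B) is the integral of F z x over B with respect to the law of Z.
   F is specified at every z in S, not only almost everywhere. *)
definition is_conditional_cdf ::
  "'a measure \<Rightarrow> ('a \<Rightarrow> real ^ 'd) \<Rightarrow> ('a \<Rightarrow> real ^ 'p) \<Rightarrow> (real ^ 'p) set \<Rightarrow>
   (real ^ 'p \<Rightarrow> real ^ 'd \<Rightarrow> real) \<Rightarrow> bool" where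
  "is_conditional_cdf M X Z S F \<longleftrightarrow>
     (\<forall>z\<in>S. is_joint_cdf (F z)) \<and>
     (\<forall>x. (\<lambda>z. F z x) \<in> borel_measurable (restrict_space borel S)) \<and>
     (\<forall>x. \<forall>B\<in>sets (restrict_space borel S).
        measure M {\<omega>\<in>space M. X \<omega> \<le> x \<and> Z \<omega> \<in> B} =
        (LINT z:B|distr M (restrict_space borel S) Z. F z x))"

definition H0_equality ::
  "'z set \<Rightarrow> ('z \<Rightarrow> real ^ 'd \<Rightarrow> real) \<Rightarrow> bool" where
  "H0_equality S F \<longleftrightarrow>
     (\<forall>z\<in>S. \<forall>z'\<in>S. possible_copulas (F z) = possible_copulas (F z'))"

definition H0_intersection ::
  "'z set \<Rightarrow> ('z \<Rightarrow> real ^ 'd \<Rightarrow> real) \<Rightarrow> bool" where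
  "H0_intersection S F \<longleftrightarrow> (\<Inter>z\<in>S. possible_copulas (F z)) \<noteq> {}"

definition H0_pairwise ::
  "'z set \<Rightarrow> ('z \<Rightarrow> real ^ 'd \<Rightarrow> real) \<Rightarrow> bool" where
  "H0_pairwise S F \<longleftrightarrow>
     (\<forall>z\<in>S. \<forall>z'\<in>S. possible_copulas (F z) \<inter> possible_copulas (F z') \<noteq> {})"

(* The conditional copula given Z = z is any element of possible_copulas (F z); all of them agree
   on Dom (F z), so the condition is imposed for every choice of representatives. *)
definition H0_Dom ::
  "'z set \<Rightarrow> ('z \<Rightarrow> real ^ 'd \<Rightarrow> real) \<Rightarrow> bool" where
  "H0_Dom S F \<longleftrightarrow>
     (\<forall>z\<in>S. \<forall>z'\<in>S. \<forall>u\<in>Dom (F z) \<inter> Dom (F z').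
        \<forall>C\<in>possible_copulas (F z). \<forall>C'\<in>possible_copulas (F z'). C u = C' u)"

end

theory Submission imports Defs begin

text \<open>The one substantial step is the existence part of Sklar's theorem without continuity of the
  margins. It is obtained from the distributional transform: for \<open>V\<close> uniform on \<open>[0,1]\<close> and
  independent of the vector \<open>X\<close>, the variables \<open>U\<^sub>i = G\<^sub>i(X\<^sub>i-) + V (G\<^sub>i(X\<^sub>i) - G\<^sub>i(X\<^sub>i-))\<close> are uniform,
  and almost surely \<open>U\<^sub>i \<le> G\<^sub>i(t)\<close> iff \<open>X\<^sub>i \<le> t\<close>. So the distribution function of \<open>U\<close> is a copula
  of \<open>X\<close>.\<close>

section \<open>The uniform randomisation on the unit interval\<close>

text \<open>Since the space itself is cut down to \<open>{0..1}\<close>, the bounds on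
  \<open>v\<close> hold at every point and not merely almost everywhere.\<close>

definition unit_measure :: "real measure" where
  "unit_measure = restrict_space lborel {0..1}"

lemma space_unit_measure [simp]: "space unit_measure = {0..1}"
  by (simp add: unit_measure_def space_restrict_space)

lemma prob_space_unit_measure: "prob_space unit_measure"
  by (auto simp: unit_measure_def space_restrict_space emeasure_restrict_space intro!: prob_spaceI)

lemma measurable_id_unit_measure [measurable]: "(\<lambda>v. v) \<in> borel_measurable unit_measure"
  unfolding unit_measure_def by (intro measurable_restrict_space1) simp

text \<open>This is P(V < b/p) = b/p with the division cleared, so that it also covers
  \<open>p = 0\<close>, which forces \<open>b = 0\<close>. It gives the share of an atom of mass
  \<open>p\<close> that is sent below a given level.\<close>

lemma measure_unit_measure_mult_less:
  assumes "0 \<le> b" "b \<le> p"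
  shows "p * measure unit_measure {v \<in> {0..1}. v * p < b} = b"
proof (cases "p = 0")
  case False
  then have p: "p > 0" using assms by simp
  have "{v \<in> {0..1}. v * p < b} = {0..<b / p}"
  proof -
    have "v \<le> 1" if "v * p < b" for v
    proof -
      have "v * p < 1 * p" using that assms by simp
      then show ?thesis using p by (simp only: mult_less_cancel_right_pos less_imp_le)
    qed
    then show ?thesis using p by (auto simp: pos_less_divide_eq)
  qed
  moreover have "measure unit_measure {0..<b / p} = b / p"
  proof -
    have "b / p \<le> 1" using p assms by simp
    then have "{0..<b / p} \<subseteq> {0..1}" by auto
    then show ?thesis
      using p assms unfolding unit_measure_def by (subst measure_restrict_space) auto
  qed
  ultimately show ?thesis using p by simp
qed (use assms in auto)

section \<open>Jumps and quantiles of a real distribution\<close>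

text \<open>The term \<open>measure D {..<x}\<close> is the left limit of the distribution function
  at \<open>x\<close>, so \<open>v\<close> interpolates linearly across the jump there.\<close>

definition dist_transform :: "real measure \<Rightarrow> real \<Rightarrow> real \<Rightarrow> real" where
  "dist_transform D x v = measure D {..<x} + v * (cdf D x - measure D {..<x})"

context real_distribution
begin

lemma cdf_eq_lessThan_plus: "cdf M x = measure M {..<x} + measure M {x}"
proof -
  have "{..x} = {..<x} \<union> {x}" by auto
  then show ?thesis
    unfolding cdf_def2 by (simp add: finite_measure_Union del: Un_insert_right)
qed

lemma measure_lessThan_le_cdf: "measure M {..<x} \<le> cdf M x"
  by (simp add: cdf_eq_lessThan_plus)

lemma cdf_le_measure_lessThan: "x < y \<Longrightarrow> cdf M x \<le> measure M {..<y}"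
  unfolding cdf_def2 by (intro finite_measure_mono) auto

lemma borel_measurable_measure_lessThan [measurable]:
  "(\<lambda>x. measure M {..<x}) \<in> borel_measurable borel"
  by (intro borel_measurable_mono monoI finite_measure_mono) auto

lemma borel_measurable_cdf [measurable]: "cdf M \<in> borel_measurable borel"
  by (intro borel_measurable_mono monoI cdf_nondecreasing)

lemma dist_transform_bounds:
  assumes "v \<in> {0..1}"
  shows "measure M {..<x} \<le> dist_transform M x v" "dist_transform M x v \<le> cdf M x"
proof -
  have "0 \<le> cdf M x - measure M {..<x}"
    using measure_lessThan_le_cdf[of x] by simp
  then show "measure M {..<x} \<le> dist_transform M x v" "dist_transform M x v \<le> cdf M x"
    using assms mult_left_le_one_le[of "cdf M x - measure M {..<x}" v]
    by (auto simp: dist_transform_def)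
qed

text \<open>The generalised inverse of the distribution function serves as \<open>q\<close>. Below
  \<open>q\<close> the distribution function stays under \<open>u\<close>, hence so does its left
  limit at \<open>q\<close>, up to equality.\<close>

lemma quantile_exists:
  assumes "0 < u" "u < 1"
  obtains q where "\<And>y. u \<le> cdf M y \<longleftrightarrow> q \<le> y" "measure M {..<q} \<le> u"
proof -
  interpret cdf_distribution M ..
  have q: "u \<le> cdf M y \<longleftrightarrow> I u \<le> y" for y
    using assms by (rule pseudoinverse)
  have "cdf M y \<le> u" if "y < I u" for y
    using q[of y] that by linarith
  then have "eventually (\<lambda>y. cdf M y \<le> u) (at_left (I u))"
    by (simp add: eventually_at_filter)
  then have "measure M {..<I u} \<le> u"
    by (intro tendsto_upperbound[OF cdf_at_left]) auto
  with q that show ?thesis by blast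
qed

end

section \<open>Law of the distributional transform\<close>

lemma (in prob_space) measurable_dist_transform [measurable]:
  assumes [measurable]: "X \<in> borel_measurable M"
  shows "(\<lambda>w. dist_transform (distr M borel X) (X (fst w)) (snd w))
           \<in> borel_measurable (M \<Otimes>\<^sub>M unit_measure)"
proof -
  interpret D: real_distribution "distr M borel X" by simp
  have [measurable]: "snd \<in> borel_measurable (M \<Otimes>\<^sub>M unit_measure)"
    using measurable_compose[OF measurable_snd measurable_id_unit_measure] by simp
  note [measurable] = D.borel_measurable_measure_lessThan D.borel_measurable_cdf
  show ?thesis
    unfolding dist_transform_def by measurable
qed

text \<open>Split at the quantile \<open>q\<close> of level \<open>u\<close>: the event is certain
  for X < q, impossible for X > q, and on the atom X = q it is a condition on V alone. By
  independence the total is G(q-) + (u - G(q-)). The strict inequality matters: for X > q the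
  transform is at least G(q), which may equal \<open>u\<close>.\<close>

lemma (in prob_space) prob_dist_transform_less:
  assumes [measurable]: "X \<in> borel_measurable M" and u: "0 < u" "u < 1"
  shows "measure (M \<Otimes>\<^sub>M unit_measure)
           {w \<in> space (M \<Otimes>\<^sub>M unit_measure).
              dist_transform (distr M borel X) (X (fst w)) (snd w) < u} = u"
proof -
  define D where "D = distr M borel X"
  interpret D: real_distribution D unfolding D_def by simp
  interpret V: prob_space unit_measure by (rule prob_space_unit_measure)
  interpret P: pair_prob_space M unit_measure ..
  obtain q where q: "\<And>y. u \<le> cdf D y \<longleftrightarrow> q \<le> y" and qu: "measure D {..<q} \<le> u"
    using D.quantile_exists[OF u] by blast
  define p where "p = cdf D q - measure D {..<q}"
  define B where "B = {v \<in> {0..1}. v * p < u - measure D {..<q}}"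
  have "{v \<in> space unit_measure. v * p < u - measure D {..<q}} \<in> sets unit_measure"
    by measurable
  then have B [measurable]: "B \<in> sets unit_measure"
    by (simp add: B_def)
  let ?A1 = "{\<omega> \<in> space M. X \<omega> < q}" and ?A2 = "{\<omega> \<in> space M. X \<omega> = q}"
  have lt: "dist_transform D x v < u \<longleftrightarrow> x < q \<or> x = q \<and> v * p < u - measure D {..<q}"
    if v: "v \<in> {0..1}" for x v
  proof (cases x q rule: linorder_cases)
    case less
    then show ?thesis using q[of x] D.dist_transform_bounds[OF v, of x] by auto
  next
    case equal
    then show ?thesis by (auto simp: dist_transform_def p_def)
  next
    case greater
    then show ?thesis
      using q[of q] D.cdf_le_measure_lessThan[OF greater] D.dist_transform_bounds[OF v, of x] by auto
  qed
  have "{w \<in> space (M \<Otimes>\<^sub>M unit_measure). dist_transform D (X (fst w)) (snd w) < u}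
      = ?A1 \<times> space unit_measure \<union> ?A2 \<times> B"
    using lt by (auto simp: space_pair_measure B_def)
  also have "measure (M \<Otimes>\<^sub>M unit_measure) \<dots>
      = measure (M \<Otimes>\<^sub>M unit_measure) (?A1 \<times> space unit_measure)
        + measure (M \<Otimes>\<^sub>M unit_measure) (?A2 \<times> B)"
    by (intro P.finite_measure_Union) (auto intro!: pair_measureI simp del: space_unit_measure)
  also have "\<dots> = measure M ?A1 + measure M ?A2 * measure unit_measure B"
    using V.prob_space
    by (simp add: measure_def V.emeasure_pair_measure_Times enn2real_mult del: space_unit_measure)
  also have "measure M ?A1 = measure D {..<q}"
    by (auto simp: D_def measure_distr intro!: arg_cong[where f = "measure M"])
  also have "measure M ?A2 = p"
    by (auto simp: p_def D.cdf_eq_lessThan_plus)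
       (auto simp: D_def measure_distr intro!: arg_cong[where f = "measure M"])
  \<comment> \<open>The two quantile properties say G(q-) \<le> u \<le> G(q), so the level to be
    reached inside the jump lies between 0 and \<open>p\<close>.\<close>
  also have "p * measure unit_measure B = u - measure D {..<q}"
    unfolding B_def using qu q[of q] by (intro measure_unit_measure_mult_less) (auto simp: p_def)
  finally show ?thesis by (simp add: D_def)
qed

lemma real_distribution_uniform: "real_distribution (uniform_measure lborel {0..1::real})"
  by (intro real_distribution.intro prob_space_uniform_measure real_distribution_axioms.intro) auto

lemma cdf_uniform:
  "cdf (uniform_measure lborel {0..1}) u = (if u < 0 then 0 else if u \<le> 1 then u else 1)"
proof -
  have "{0..1} \<inter> {..u} = {0..min u 1}" by auto
  then show ?thesis by (simp add: cdf_def2 min_def)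
qed

text \<open>The distribution function is squeezed between probabilities of strict events: from below
  at the level \<open>u\<close> itself, from above at levels \<open>u'\<close> decreasing to
  \<open>u\<close>. Outside the open unit interval the pointwise bounds on the transform take
  over.\<close>

lemma (in prob_space) distr_dist_transform:
  assumes [measurable]: "X \<in> borel_measurable M"
  shows "distr (M \<Otimes>\<^sub>M unit_measure) borel
           (\<lambda>w. dist_transform (distr M borel X) (X (fst w)) (snd w))
         = uniform_measure lborel {0..1}" (is "distr ?P borel ?T = _")
proof -
  interpret D: real_distribution "distr M borel X" by simp
  interpret V: prob_space unit_measure by (rule prob_space_unit_measure)
  interpret P: pair_prob_space M unit_measure ..
  have T [measurable]: "?T \<in> borel_measurable ?P" by measurable
  interpret U: real_distribution "distr ?P borel ?T" using T by (rule P.real_distribution_distr)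
  have bounds: "0 \<le> ?T w" "?T w \<le> 1" if "w \<in> space ?P" for w
  proof -
    from that have v: "snd w \<in> {0..1}" by (auto simp: space_pair_measure)
    show "0 \<le> ?T w" "?T w \<le> 1"
      using order_trans[OF measure_nonneg D.dist_transform_bounds(1)[OF v]]
        order_trans[OF D.dist_transform_bounds(2)[OF v] D.cdf_bounded_prob] by auto
  qed
  have cdf_eq: "cdf (distr ?P borel ?T) u = measure ?P {w \<in> space ?P. ?T w \<le> u}" for u
    unfolding cdf_def2 by (subst measure_distr) (auto intro!: arg_cong[where f = "measure ?P"])
  have ge: "u \<le> cdf (distr ?P borel ?T) u" if "0 < u" "u < 1" for u
  proof -
    have "u = measure ?P {w \<in> space ?P. ?T w < u}"
      using prob_dist_transform_less[OF assms that] by simp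
    also have "\<dots> \<le> measure ?P {w \<in> space ?P. ?T w \<le> u}"
      by (intro P.finite_measure_mono) auto
    finally show ?thesis by (simp add: cdf_eq)
  qed
  \<comment> \<open>The value \<open>u = 0\<close> is included here, which rules out an atom at
    0.\<close>
  have le: "cdf (distr ?P borel ?T) u \<le> u" if "0 \<le> u" "u < 1" for u
  proof (rule dense_ge_bounded[OF that(2)])
    fix u' assume u': "u < u'" "u' < 1"
    have "measure ?P {w \<in> space ?P. ?T w \<le> u} \<le> measure ?P {w \<in> space ?P. ?T w < u'}"
      using u' by (intro P.finite_measure_mono) auto
    then show "cdf (distr ?P borel ?T) u \<le> u'"
      using prob_dist_transform_less[OF assms, of u'] u' that by (simp add: cdf_eq)
  qed
  have "cdf (distr ?P borel ?T) u = cdf (uniform_measure lborel {0..1}) u" for u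
  proof -
    consider "u < 0" | "u = 0" | "0 < u" "u < 1" | "1 \<le> u" by linarith
    then show ?thesis
    proof cases
      case 1
      then have "{w \<in> space ?P. ?T w \<le> u} = {}" using bounds(1) by fastforce
      then have "cdf (distr ?P borel ?T) u = 0" unfolding cdf_eq by (simp only: measure_empty)
      then show ?thesis using 1 by (simp add: cdf_uniform)
    next
      case 2
      then show ?thesis using le[of 0] U.cdf_nonneg[of 0] by (simp add: cdf_uniform)
    next
      case 3
      then show ?thesis using le[of u] ge[of u] by (simp add: cdf_uniform)
    next
      case 4
      then have "{w \<in> space ?P. ?T w \<le> u} = space ?P" using bounds(2) by fastforce
      then have "cdf (distr ?P borel ?T) u = 1"
        unfolding cdf_eq using P.prob_space by (simp only:)
      then show ?thesis using 4 by (auto simp: cdf_uniform)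
    qed
  qed
  then show ?thesis
    by (intro cdf_unique ext real_distribution_uniform U.real_distribution_axioms)
qed

text \<open>\<open>X \<le> t\<close> implies \<open>U \<le> G(t)\<close> for the transform \<open>U\<close>, and both events have probability \<open>G(t)\<close>.\<close>

lemma (in prob_space) AE_dist_transform_le_cdf_iff:
  assumes [measurable]: "X \<in> borel_measurable M"
  shows "AE w in M \<Otimes>\<^sub>M unit_measure.
           dist_transform (distr M borel X) (X (fst w)) (snd w) \<le> cdf (distr M borel X) t
           \<longleftrightarrow> X (fst w) \<le> t" (is "AE w in ?P. ?T w \<le> ?G \<longleftrightarrow> _")
proof -
  interpret D: real_distribution "distr M borel X" by simp
  interpret V: prob_space unit_measure by (rule prob_space_unit_measure)
  interpret P: pair_prob_space M unit_measure ..
  have T [measurable]: "?T \<in> borel_measurable ?P" by measurable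
  let ?E = "{w \<in> space ?P. X (fst w) \<le> t}" and ?E' = "{w \<in> space ?P. ?T w \<le> ?G}"
  have E [measurable]: "?E \<in> sets ?P" "?E' \<in> sets ?P" by measurable
  have sub: "?E \<subseteq> ?E'"
  proof safe
    fix x v assume w: "(x, v) \<in> space ?P" "X (fst (x, v)) \<le> t"
    then have "v \<in> {0..1}" by (auto simp: space_pair_measure)
    from D.dist_transform_bounds(2)[OF this, of "X x"] D.cdf_nondecreasing[of "X x" t] w
    show "?T (x, v) \<le> ?G" by simp
  qed
  have "measure ?P ?E' = cdf (distr ?P borel ?T) ?G"
    unfolding cdf_def2
    by (subst measure_distr) (auto intro!: arg_cong[where f = "measure ?P"])
  also have "\<dots> = ?G"
    using D.cdf_nonneg[of t] D.cdf_bounded_prob[of t] by (simp add: distr_dist_transform cdf_uniform)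
  finally have E': "measure ?P ?E' = ?G" .
  have "?E = {\<omega> \<in> space M. X \<omega> \<le> t} \<times> space unit_measure"
    by (auto simp: space_pair_measure)
  then have "measure ?P ?E = measure M {\<omega> \<in> space M. X \<omega> \<le> t}"
    using V.prob_space
    by (simp add: measure_def V.emeasure_pair_measure_Times enn2real_mult del: space_unit_measure)
  also have "\<dots> = ?G"
    by (auto simp: cdf_def2 measure_distr intro!: arg_cong[where f = "measure M"])
  finally have "measure ?P (?E' - ?E) = 0"
    using E' P.finite_measure_Diff[OF E(2,1) sub] by simp
  then have "?E' - ?E \<in> null_sets ?P"
    by (intro null_setsI) (auto simp: P.emeasure_eq_measure)
  then show ?thesis
    by (rule AE_I') (use sub in auto)
qed

section \<open>Margins of a joint distribution function\<close>

lemma borel_measurable_vec_component [measurable]: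
  "(\<lambda>x :: real ^ 'd. x $ i) \<in> borel_measurable borel"
  by (intro borel_measurable_continuous_onI continuous_intros)

text \<open>The orthants whose other coordinates are bounded by \<open>n\<close> increase to the
  half-space of all \<open>x\<close> with \<open>x $ i \<le> t\<close>, so continuity from below
  gives the limit along the integers. Monotonicity extends it to the real limit that defines
  \<open>margin\<close>.\<close>

lemma margin_joint_cdf:
  fixes \<mu> :: "(real ^ 'd) measure"
  assumes "prob_space \<mu>" and sets_\<mu>: "sets \<mu> = sets borel"
  shows "margin (joint_cdf \<mu>) i t = cdf (distr \<mu> borel (\<lambda>x. x $ i)) t"
proof -
  interpret prob_space \<mu> by fact
  have space_\<mu>: "space \<mu> = UNIV" using sets_eq_imp_space_eq[OF sets_\<mu>] by simp
  have [measurable_cong]: "sets \<mu> = sets borel" by fact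
  let ?v = "\<lambda>s. (\<chi> j. if j = i then t else s) :: real ^ 'd"
  let ?f = "\<lambda>s. joint_cdf \<mu> (?v s)"
  have v_mono: "s \<le> s' \<Longrightarrow> ?v s \<le> ?v s'" for s s'
    by (auto simp: less_eq_vec_def)
  have mono: "?f s \<le> ?f s'" if "s \<le> s'" for s s'
    unfolding joint_cdf_def using v_mono[OF that]
    by (intro finite_measure_mono) (auto simp: sets_\<mu> intro: order_trans)
  have un: "(\<Union>n. {..?v (real n)}) = {x. x $ i \<le> t}"
  proof safe
    fix x :: "real ^ 'd" assume x: "x $ i \<le> t"
    obtain n where n: "Max (range (($) x)) \<le> real n" using real_arch_simple by blast
    have "x $ j \<le> real n" for j by (intro order_trans[OF Max_ge n]) auto
    with x show "x \<in> (\<Union>n. {..?v (real n)})" by (auto simp: less_eq_vec_def)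
  qed (auto simp: less_eq_vec_def split: if_splits dest: spec[of _ i])
  have "(\<lambda>n. measure \<mu> {..?v (real n)}) \<longlonglongrightarrow> measure \<mu> (\<Union>n. {..?v (real n)})"
    using v_mono by (intro finite_Lim_measure_incseq)
      (auto simp: incseq_def sets_\<mu> intro: order_trans)
  then have "(?f \<longlongrightarrow> measure \<mu> {x. x $ i \<le> t}) at_top"
    unfolding un using mono
    by (intro tendsto_at_topI_sequentially_real) (auto simp: joint_cdf_def intro!: monoI)
  then have "margin (joint_cdf \<mu>) i t = measure \<mu> {x. x $ i \<le> t}"
    unfolding margin_def by (intro tendsto_Lim) auto
  also have "\<dots> = cdf (distr \<mu> borel (\<lambda>x. x $ i)) t"
    unfolding cdf_def2 by (subst measure_distr, measurable)
      (auto simp: space_\<mu> intro!: arg_cong[where f = "measure \<mu>"])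
  finally show ?thesis .
qed

section \<open>Existence of a copula for arbitrary margins\<close>

theorem sklar_existence:
  fixes F :: "real ^ 'd \<Rightarrow> real"
  assumes "is_joint_cdf F"
  shows "possible_copulas F \<noteq> {}"
proof -
  from assms obtain \<mu> where "prob_space \<mu>" and sets_\<mu>: "sets \<mu> = sets borel"
    and F: "F = joint_cdf \<mu>"
    unfolding is_joint_cdf_def by blast
  interpret prob_space \<mu> by fact
  interpret V: prob_space unit_measure by (rule prob_space_unit_measure)
  interpret P: pair_prob_space \<mu> unit_measure ..
  have [measurable_cong]: "sets \<mu> = sets borel" by fact
  have space_\<mu>: "space \<mu> = UNIV" using sets_eq_imp_space_eq[OF sets_\<mu>] by simp
  let ?P = "\<mu> \<Otimes>\<^sub>M unit_measure"
  define D where "D i = distr \<mu> borel (\<lambda>x. x $ i)" for i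
  have D: "real_distribution (D i)" for i
    unfolding D_def by (rule real_distribution_distr) measurable
  \<comment> \<open>One and the same uniform variable \<open>snd w\<close> drives all coordinates.
    This suffices, because only the law of each single \<open>T i\<close> and its relation to the
    coordinate \<open>i\<close> of \<open>fst w\<close> enter below.\<close>
  define T where "T i w = dist_transform (D i) (fst w $ i) (snd w)" for i w
  have T [measurable]: "T i \<in> borel_measurable ?P" for i
    unfolding T_def D_def by measurable
  define U where "U w = (\<chi> i. T i w)" for w
  have U [measurable]: "U \<in> borel_measurable ?P"
    unfolding U_def by (subst borel_measurable_euclidean_space)
      (auto simp: Basis_vec_def inner_axis)
  define C where "C = restrict (joint_cdf (distr ?P borel U)) unit_cube"
  have "distr (distr ?P borel U) borel (\<lambda>x. x $ i) = uniform_measure lborel {0..1}" for i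
  proof -
    have "distr (distr ?P borel U) borel (\<lambda>x. x $ i) = distr ?P borel (T i)"
      by (subst distr_distr) (auto simp: comp_def U_def)
    also have "\<dots> = uniform_measure lborel {0..1}"
      unfolding T_def D_def by (rule distr_dist_transform) measurable
    finally show ?thesis .
  qed
  then have "is_copula C"
    unfolding is_copula_def C_def by (auto intro!: exI[of _ "distr ?P borel U"] P.prob_space_distr)
  moreover have "F x = C (\<chi> i. margin F i (x $ i))" for x
  proof -
    let ?u = "\<chi> i. margin F i (x $ i)"
    have m: "margin F i t = cdf (D i) t" for i t
      unfolding F D_def by (rule margin_joint_cdf) fact+
    \<comment> \<open>Inside the cube \<open>C\<close> is the joint distribution function of
      \<open>U\<close>; outside it \<open>restrict\<close> would return
      \<open>undefined\<close>.\<close>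
    have u: "?u \<in> unit_cube"
      using real_distribution.cdf_bounded_prob[OF D]
        finite_borel_measure.cdf_nonneg[OF real_distribution.finite_borel_measure_M[OF D]]
      by (auto simp: unit_cube_def m)
    \<comment> \<open>The index type is finite, so the exceptional null sets of the coordinates
      combine into one.\<close>
    have "AE w in ?P. \<forall>i. T i w \<le> cdf (D i) (x $ i) \<longleftrightarrow> fst w $ i \<le> x $ i"
      unfolding AE_all_countable T_def D_def
      by (intro allI AE_dist_transform_le_cdf_iff) measurable
    then have "AE w in ?P. U w \<le> ?u \<longleftrightarrow> fst w \<le> x"
      by eventually_elim (simp add: U_def m less_eq_vec_def)
    then have "measure ?P {w \<in> space ?P. U w \<le> ?u} = measure ?P {w \<in> space ?P. fst w \<le> x}"
      by (intro measure_eq_AE) (auto simp: less_eq_vec_def)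
    also have "{w \<in> space ?P. fst w \<le> x} = {..x} \<times> space unit_measure"
      by (auto simp: space_pair_measure space_\<mu>)
    also have "measure ?P \<dots> = measure \<mu> {..x}"
      using V.prob_space
      by (simp add: measure_def V.emeasure_pair_measure_Times sets_\<mu> enn2real_mult
          del: space_unit_measure)
    also have "\<dots> = F x" by (simp only: F joint_cdf_def)
    finally have "F x = measure ?P {w \<in> space ?P. U w \<le> ?u}" by (rule sym)
    also have "\<dots> = joint_cdf (distr ?P borel U) ?u"
      unfolding joint_cdf_def by (subst measure_distr)
        (auto intro!: arg_cong[where f = "measure ?P"])
    also have "\<dots> = C ?u" using u by (simp add: C_def)
    finally show ?thesis .
  qed
  ultimately show ?thesis unfolding possible_copulas_def by blast
qed

section \<open>The implications between the hypotheses\<close>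

text \<open>Each coordinate of \<open>u\<close> is attained by its margin at some point; collecting
  these points into a vector \<open>x\<close>, both copulas take the value \<open>F x\<close> at
  \<open>u\<close>.\<close>

lemma possible_copula_eq_on_Dom:
  assumes "C \<in> possible_copulas F" "C' \<in> possible_copulas F" "u \<in> Dom F"
  shows "C u = C' u"
proof -
  from assms(3) have "\<forall>i. \<exists>t. u $ i = margin F i t" by (auto simp: Dom_def)
  then obtain t where "\<And>i. u $ i = margin F i (t i)" by metis
  then have "u = (\<chi> i. margin F i ((\<chi> j. t j) $ i))" by (simp add: vec_eq_iff)
  then show ?thesis using assms(1,2) unfolding possible_copulas_def by (metis (mono_tags) mem_Collect_eq)
qed

theorem proposition17:
  fixes M :: "'a measure"
    and X :: "'a \<Rightarrow> real ^ 'd"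
    and Z :: "'a \<Rightarrow> real ^ 'p"
    and S :: "(real ^ 'p) set"
    and F :: "real ^ 'p \<Rightarrow> real ^ 'd \<Rightarrow> real"
  assumes "prob_space M"
    and "X \<in> borel_measurable M"
    and "Z \<in> measurable M (restrict_space borel S)"
    and "is_conditional_cdf M X Z S F"
  shows "(H0_equality S F \<longrightarrow> H0_intersection S F) \<and>
         (H0_intersection S F \<longrightarrow> H0_pairwise S F) \<and>
         (H0_pairwise S F \<longrightarrow> H0_Dom S F)"
proof (intro conjI impI)
  assume eq: "H0_equality S F"
  \<comment> \<open>A probability space has a point, and \<open>Z\<close> maps it into
    \<open>S\<close>. A copula at this single \<open>z\<close> then belongs to all the sets, as
    these are equal.\<close>
  from prob_space.not_empty[OF assms(1)] assms(3) obtain z where z: "z \<in> S"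
    by (auto simp: measurable_def space_restrict_space)
  with assms(4) have "is_joint_cdf (F z)" unfolding is_conditional_cdf_def by blast
  then obtain C where "C \<in> possible_copulas (F z)" using sklar_existence by blast
  with eq z show "H0_intersection S F" unfolding H0_equality_def H0_intersection_def by blast
next
  assume "H0_intersection S F"
  then show "H0_pairwise S F" unfolding H0_intersection_def H0_pairwise_def by blast
next
  assume pair: "H0_pairwise S F"
  show "H0_Dom S F"
    unfolding H0_Dom_def
  proof (intro ballI)
    fix z z' u C C'
    assume z: "z \<in> S" "z' \<in> S" and u: "u \<in> Dom (F z) \<inter> Dom (F z')"
      and C: "C \<in> possible_copulas (F z)" "C' \<in> possible_copulas (F z')"
    \<comment> \<open>The common copula \<open>E\<close> links the two arbitrary representatives: it
      agrees with \<open>C\<close> on \<open>Dom (F z)\<close> and with \<open>C'\<close> on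
      \<open>Dom (F z')\<close>, and \<open>u\<close> lies in both.\<close>
    from pair z obtain E where "E \<in> possible_copulas (F z)" "E \<in> possible_copulas (F z')"
      unfolding H0_pairwise_def by blast
    with C u show "C u = C' u" using possible_copula_eq_on_Dom by (metis IntE)
  qed
qed

end
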